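(* Let $n\ge1$ and consider the Boolean cube $\{0,1\}^n$. For every $E\subsetneq[0,n]$: (a) $\mathsf{HC}_n(E)=\mathsf{PC}_n(E)=\min\{d\in[0,n]: E\text{ is } d\text{-admitting}\}$; (b) $\mathsf{PHC}_n(E)=\mathsf{PPC}_n(E)=|E|-\max\{i\in[0,\lfloor n/2\rfloor]: T_{n,i}\subseteq E\}$.
   Context: For integers $a\le b$, $[a,b]$ denotes the set of integers $t$ with $a\le t\le b$ (and $[a,b]=\emptyset$ if $a>b$). For $E\subseteq[0,n]$ let $\underline{E}\subseteq\{0,1\}^n$ be the set of points whose Hamming weight lies in $E$, and $\underline{j}=\underline{\{j\}}$. Let $E\subsetneq[0,n]$. A family $\mathcal{H}$ of (affine) hyperplanes in $\mathbb{R}^n$ is a nontrivial hyperplane cover of $\underline{E}$ if $\underline{E}\subseteq\{0,1\}^n\cap\bigcup_{H\in\mathcal{H}}H\ne\{0,1\}^n$; it is a proper hyperplane cover of $\underline{E}$ if $\underline{E}\subseteq\bigcup_{H\in\mathcal{H}}H$ and $\underline{j}\not\subseteq\bigcup_{H\in\mathcal{H}}H$ for every $j\in[0,n]\setminus E$. $\mathsf{HC}_n(E)$ and $\mathsf{PHC}_n(E)$ are the minimum sizes of a nontrivial, respectively proper, hyperplane cover of $\underline{E}$. For $P\in\mathbb{R}[X_1,\ldots,X_n]$ let $\mathcal{Z}(P)=\{a\in\{0,1\}^n:P(a)=0\}$. $P$ is a nontrivial polynomial cover of $\underline{E}$ if $\underline{E}\subseteq\mathcal{Z}(P)\ne\{0,1\}^n$;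 it is a proper polynomial cover of $\underline{E}$ if $\underline{E}\subseteq\mathcal{Z}(P)$ and $\underline{j}\not\subseteq\mathcal{Z}(P)$ for every $j\in[0,n]\setminus E$. $\mathsf{PC}_n(E)$ and $\mathsf{PPC}_n(E)$ are the minimum degrees of a nontrivial, respectively proper, polynomial cover of $\underline{E}$. For $i\in[0,n]$ let $T_{n,i}=[0,i-1]\cup[n-i+1,n]$ (so $T_{n,0}=\emptyset$). For $d,i\in[0,n]$ with $i\le d$, a set $E\subseteq[0,n]$ is $(d,i)$-admitting if $E\cup T_{n,i}\ne[0,n]$ and $|E\setminus T_{n,i}|\le d-i$. $E$ is $d$-admitting if it is $(d,i)$-admitting for some $i\in[0,d]$. *)

theory Defs
  imports "HOL-Analysis.Analysis" "HOL-Library.Poly_Mapping"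
begin

text \<open>The ambient space of dimension \<open>n\<close> is \<open>real ^ 'n\<close> with \<open>n = CARD('n)\<close>.\<close>

definition cube :: "(real ^ 'n::finite) set" where
  "cube = {x. \<forall>i. x $ i \<in> {0, 1}}"

definition hamming_weight :: "real ^ 'n::finite \<Rightarrow> nat" where
  "hamming_weight x = card {i. x $ i \<noteq> 0}"

definition layers :: "nat set \<Rightarrow> (real ^ 'n::finite) set" where
  "layers E = {x \<in> cube. hamming_weight x \<in> E}"


definition hyperplane :: "(real ^ 'n::finite) set \<Rightarrow> bool" where
  "hyperplane H \<longleftrightarrow> (\<exists>a b. a \<noteq> 0 \<and> H = {x. a \<bullet> x = b})"

definition nontrivial_hyperplane_cover :: "nat set \<Rightarrow> (real ^ 'n::finite) set set \<Rightarrow> bool" where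
  "nontrivial_hyperplane_cover E \<H> \<longleftrightarrow>
     (\<forall>H\<in>\<H>. hyperplane H) \<and> layers E \<subseteq> cube \<inter> \<Union>\<H> \<and> cube \<inter> \<Union>\<H> \<noteq> cube"

definition proper_hyperplane_cover :: "nat set \<Rightarrow> (real ^ 'n::finite) set set \<Rightarrow> bool" where
  "proper_hyperplane_cover E \<H> \<longleftrightarrow>
     (\<forall>H\<in>\<H>. hyperplane H) \<and> layers E \<subseteq> \<Union>\<H> \<and>
     (\<forall>j\<in>{0..CARD('n)} - E. \<not> layers {j} \<subseteq> \<Union>\<H>)"

text \<open>Finiteness is demanded because \<open>card\<close> of an infinite family is \<open>0\<close>.\<close>

definition HC :: "'n::finite itself \<Rightarrow> nat set \<Rightarrow> nat" where
  "HC TYPE('n) E =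
     (LEAST k. \<exists>\<H> :: (real ^ 'n) set set.
        finite \<H> \<and> card \<H> = k \<and> nontrivial_hyperplane_cover E \<H>)"

definition PHC :: "'n::finite itself \<Rightarrow> nat set \<Rightarrow> nat" where
  "PHC TYPE('n) E =
     (LEAST k. \<exists>\<H> :: (real ^ 'n) set set.
        finite \<H> \<and> card \<H> = k \<and> proper_hyperplane_cover E \<H>)"


text \<open>A monomial is its finitely supported exponent vector \<open>'n \<Rightarrow>\<^sub>0 nat\<close>, and a real polynomial
  in variables indexed by \<open>'n\<close> is its finitely supported family of coefficients.\<close>

type_synonym 'n real_mpoly = "('n \<Rightarrow>\<^sub>0 nat) \<Rightarrow>\<^sub>0 real"

definition mpoly_eval :: "'n::finite real_mpoly \<Rightarrow> real ^ 'n \<Rightarrow> real" where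
  "mpoly_eval P x =
     (\<Sum>m\<in>Poly_Mapping.keys P. Poly_Mapping.lookup P m * (\<Prod>i\<in>UNIV. (x $ i) ^ Poly_Mapping.lookup m i))"

text \<open>Total degree. The zero polynomial gets degree \<open>0\<close>, but it is never a nontrivial cover, nor a
  proper cover of layers \<open>E\<close> with \<open>E\<close> a proper subset of \<open>{0..CARD('n)}\<close>.\<close>

definition mpoly_degree :: "'n::finite real_mpoly \<Rightarrow> nat" where
  "mpoly_degree P =
     Max (insert 0 ((\<lambda>m. \<Sum>i\<in>UNIV. Poly_Mapping.lookup m i) ` Poly_Mapping.keys P))"

definition cube_zeros :: "'n::finite real_mpoly \<Rightarrow> (real ^ 'n) set" where
  "cube_zeros P = {a \<in> cube. mpoly_eval P a = 0}"

definition nontrivial_polynomial_cover :: "nat set \<Rightarrow> 'n::finite real_mpoly \<Rightarrow> bool" where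
  "nontrivial_polynomial_cover E P \<longleftrightarrow> layers E \<subseteq> cube_zeros P \<and> cube_zeros P \<noteq> cube"

definition proper_polynomial_cover :: "nat set \<Rightarrow> 'n::finite real_mpoly \<Rightarrow> bool" where
  "proper_polynomial_cover E P \<longleftrightarrow>
     layers E \<subseteq> cube_zeros P \<and>
     (\<forall>j\<in>{0..CARD('n)} - E. \<not> layers {j} \<subseteq> cube_zeros P)"

definition PC :: "'n::finite itself \<Rightarrow> nat set \<Rightarrow> nat" where
  "PC TYPE('n) E =
     (LEAST d. \<exists>P :: 'n real_mpoly. mpoly_degree P = d \<and> nontrivial_polynomial_cover E P)"

definition PPC :: "'n::finite itself \<Rightarrow> nat set \<Rightarrow> nat" where
  "PPC TYPE('n) E =
     (LEAST d. \<exists>P :: 'n real_mpoly. mpoly_degree P = d \<and> proper_polynomial_cover E P)"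


text \<open>The set \<open>[0,i-1] \<union> [n-i+1,n]\<close>, for \<open>i \<le> n\<close>; it is empty for \<open>i = 0\<close>.\<close>

definition T :: "nat \<Rightarrow> nat \<Rightarrow> nat set" where
  "T n i = {0..<i} \<union> {n - i + 1..n}"

text \<open>Used for \<open>i \<le> d \<le> n\<close> only, where the subtraction does not truncate.\<close>

definition admitting_at :: "nat \<Rightarrow> nat \<Rightarrow> nat \<Rightarrow> nat set \<Rightarrow> bool" where
  "admitting_at n d i E \<longleftrightarrow> E \<union> T n i \<noteq> {0..n} \<and> card (E - T n i) \<le> d - i"

definition admitting :: "nat \<Rightarrow> nat \<Rightarrow> nat set \<Rightarrow> bool" where
  "admitting n d E \<longleftrightarrow> (\<exists>i\<in>{0..d}. admitting_at n d i E)"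

end

theory Submission
  imports Defs
begin

text \<open>
  Upper bounds: if \<open>2i \<le> n\<close>, the \<open>i\<close> hyperplanes \<open>x\<^sub>2\<^sub>k = x\<^sub>2\<^sub>k\<^sub>+\<^sub>1\<close> cover the
  layers in \<open>T n i\<close> and contain no other layer (a point off all of them has at least \<open>i\<close> ones and at least \<open>i\<close> zeros), and every
  further layer costs one hyperplane.

  Lower bounds: let \<open>P\<close> of degree at most \<open>d\<close> not vanish at a cube point of weight \<open>w\<close>. If the average of
  \<open>P\<close> over layer \<open>w\<close> is nonzero, symmetrise. Otherwise \<open>P\<close> is not constant on that layer, so some
  transposition of two coordinates \<open>a, b\<close> changes its value; then the polynomial
  \<open>P(x\<^sub>a = 1, x\<^sub>b = 0) - P(x\<^sub>a = 0, x\<^sub>b = 1)\<close> in the other \<open>n - 2\<close> coordinates has degree at most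
  \<open>d - 1\<close>, and one iterates. After \<open>i\<close> such steps the symmetrisation is a univariate polynomial of degree
  at most \<open>d - i\<close> that is nonzero at \<open>w\<close> and vanishes at every \<open>j \<in> [i, n - i]\<close> such that \<open>P\<close>
  vanishes on layer \<open>j\<close>. Counting its roots yields both lower bounds.
\<close>

section \<open>Averages over a layer as polynomials in its weight\<close>

lemma card_subsets_between:
  assumes "finite S" "B \<subseteq> S" "card B \<le> j"
  shows "card {A. B \<subseteq> A \<and> A \<subseteq> S \<and> card A = j} = (card S - card B) choose (j - card B)"
proof -
  have fB: "finite B" using assms finite_subset by blast
  have "bij_betw (\<lambda>A. A - B) {A. B \<subseteq> A \<and> A \<subseteq> S \<and> card A = j}
          {A. A \<subseteq> S - B \<and> card A = j - card B}"
  proof (rule bij_betw_byWitness[where f' = "\<lambda>A. A \<union> B"])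
    show "(\<lambda>A. A - B) ` {A. B \<subseteq> A \<and> A \<subseteq> S \<and> card A = j} \<subseteq> {A. A \<subseteq> S - B \<and> card A = j - card B}"
      using fB by (auto simp: card_Diff_subset)
    have "card (A \<union> B) = j" if "A \<subseteq> S - B" "card A = j - card B" for A
    proof -
      have "finite A" using that assms finite_subset by blast
      then show ?thesis using that assms fB by (subst card_Un_disjoint) auto
    qed
    then show "(\<lambda>A. A \<union> B) ` {A. A \<subseteq> S - B \<and> card A = j - card B} \<subseteq> {A. B \<subseteq> A \<and> A \<subseteq> S \<and> card A = j}"
      using assms by auto
  qed auto
  then have "card {A. B \<subseteq> A \<and> A \<subseteq> S \<and> card A = j} = card {A. A \<subseteq> S - B \<and> card A = j - card B}"
    by (rule bij_betw_same_card)
  also have "\<dots> = card (S - B) choose (j - card B)"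
    using assms by (intro n_subsets) auto
  finally show ?thesis using assms fB by (simp add: card_Diff_subset)
qed

text \<open>The falling factorial X (X - 1) ... (X - b + 1). It makes (j choose b), up to the factor
  b!, the value at j of a polynomial of degree b.\<close>

definition falling_poly :: "nat \<Rightarrow> real poly" where
  "falling_poly b = (\<Prod>k<b. [:- of_nat k, 1:])"

lemma degree_falling_poly: "degree (falling_poly b) \<le> b"
proof -
  have "degree (falling_poly b) \<le> sum (degree \<circ> (\<lambda>k. [:- of_nat k, 1:] :: real poly)) {..<b}"
    unfolding falling_poly_def by (rule degree_prod_sum_le) simp
  then show ?thesis by simp
qed

lemma poly_falling_poly: "poly (falling_poly b) (real j) = fact b * real (j choose b)"
  by (simp add: falling_poly_def poly_prod binomial_gbinomial gbinomial_prod_rev atLeast0LessThan)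

text \<open>With s = |S| and b = |B|, the number of j-sets between B and S is (s - b choose j - b),
  and (s choose j)(j choose b) = (s choose b)(s - b choose j - b) rewrites it as the layer size
  times a polynomial in j. For j < b both sides are 0.\<close>

lemma layer_sum_subset_indicator:
  assumes "finite S" "B \<subseteq> S" "j \<le> card S"
  shows "(\<Sum>A | A \<subseteq> S \<and> card A = j. of_bool (B \<subseteq> A))
       = real (card S choose j) * (poly (falling_poly (card B)) (real j) / (fact (card B) * real (card S choose card B)))"
proof -
  have "(\<Sum>A | A \<subseteq> S \<and> card A = j. of_bool (B \<subseteq> A)) = (\<Sum>A | B \<subseteq> A \<and> A \<subseteq> S \<and> card A = j. 1::real)"
    using assms(1) by (intro sum.mono_neutral_cong_right) auto
  also have "\<dots> = real (card {A. B \<subseteq> A \<and> A \<subseteq> S \<and> card A = j})" by simp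
  finally have *: "(\<Sum>A | A \<subseteq> S \<and> card A = j. of_bool (B \<subseteq> A)) = real (card {A. B \<subseteq> A \<and> A \<subseteq> S \<and> card A = j})" .
  have le: "card B \<le> card S" using assms by (simp add: card_mono)
  then have pos: "card S choose card B > 0" by (simp add: zero_less_binomial)
  show ?thesis
  proof (cases "card B \<le> j")
    case True
    have "(card S choose j) * (j choose card B) = (card S choose card B) * ((card S - card B) choose (j - card B))"
      using choose_mult[OF True assms(3)] .
    then have "real (card S choose j) * real (j choose card B)
        = real (card S choose card B) * real ((card S - card B) choose (j - card B))"
      by (metis of_nat_mult)
    then show ?thesis
      unfolding * card_subsets_between[OF assms(1,2) True] poly_falling_poly using pos by (simp add: field_simps)
  next
    case False
    have "card B \<le> card A" if "B \<subseteq> A" "A \<subseteq> S" for A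
      using that assms(1) by (meson card_mono finite_subset)
    then have "{A. B \<subseteq> A \<and> A \<subseteq> S \<and> card A = j} = {}"
      using False by blast
    then have "card {A. B \<subseteq> A \<and> A \<subseteq> S \<and> card A = j} = 0" by (simp only: card.empty)
    then show ?thesis unfolding * poly_falling_poly using False by (simp add: binomial_eq_0)
  qed
qed

text \<open>Symmetrisation. The indicator of \<open>K m \<subseteq> A\<close> is the value at A of
  the monomial with variable set \<open>K m\<close>; by linearity each such monomial contributes a
  multiple of the falling factorial of degree \<open>card (K m)\<close>.\<close>

lemma layer_sum_poly:
  fixes c :: "'m \<Rightarrow> real"
  assumes "finite S" "finite M" "\<And>m. m \<in> M \<Longrightarrow> K m \<subseteq> S" "\<And>m. m \<in> M \<Longrightarrow> card (K m) \<le> d"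
  shows "\<exists>q. degree q \<le> d \<and> (\<forall>j\<le>card S.
    (\<Sum>A | A \<subseteq> S \<and> card A = j. \<Sum>m\<in>M. c m * of_bool (K m \<subseteq> A)) = real (card S choose j) * poly q (real j))"
proof (intro exI conjI allI impI)
  define q where "q = (\<Sum>m\<in>M. smult (c m / (fact (card (K m)) * real (card S choose card (K m)))) (falling_poly (card (K m))))"
  show "degree q \<le> d"
    unfolding q_def
  proof (rule degree_sum_le[OF assms(2)])
    fix m assume "m \<in> M"
    then show "degree (smult (c m / (fact (card (K m)) * real (card S choose card (K m)))) (falling_poly (card (K m)))) \<le> d"
      by (intro order.trans[OF degree_smult_le] order.trans[OF degree_falling_poly] assms(4))
  qed
  fix j assume j: "j \<le> card S"
  have "(\<Sum>A | A \<subseteq> S \<and> card A = j. \<Sum>m\<in>M. c m * of_bool (K m \<subseteq> A))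
      = (\<Sum>m\<in>M. c m * (\<Sum>A | A \<subseteq> S \<and> card A = j. of_bool (K m \<subseteq> A)))"
    by (subst sum.swap) (simp add: sum_distrib_left)
  also have "\<dots> = (\<Sum>m\<in>M. c m * (real (card S choose j) * (poly (falling_poly (card (K m))) (real j) / (fact (card (K m)) * real (card S choose card (K m))))))"
    using assms(1,3) j by (intro sum.cong refl arg_cong2[where f = times] layer_sum_subset_indicator) auto
  also have "\<dots> = real (card S choose j) * poly q (real j)"
    unfolding q_def poly_sum sum_distrib_left by (intro sum.cong refl) simp
  finally show "(\<Sum>A | A \<subseteq> S \<and> card A = j. \<Sum>m\<in>M. c m * of_bool (K m \<subseteq> A)) = real (card S choose j) * poly q (real j)" .
qed

section \<open>Reduction from a function on subsets to a univariate polynomial\<close>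

lemma constant_on_layer_if_swap_invariant:
  assumes "finite S"
    and swap: "\<And>A a b. A \<subseteq> S \<Longrightarrow> card A = w \<Longrightarrow> a \<in> A \<Longrightarrow> b \<in> S - A \<Longrightarrow> f (insert b (A - {a})) = f A"
    and "A \<subseteq> S" "card A = w" "B \<subseteq> S" "card B = w"
  shows "f A = f B"
  using assms(3-6)
proof (induction "card (A - B)" arbitrary: A rule: less_induct)
  case less
  have fin: "finite A" "finite B" using less.prems assms(1) finite_subset by blast+
  show ?case
  proof (cases "A \<subseteq> B")
    case True
    then show ?thesis using card_subset_eq[OF fin(2) True] less.prems by simp
  next
    case False
    then obtain a where a: "a \<in> A" "a \<notin> B" by blast
    have "\<not> B \<subseteq> A" using card_subset_eq[OF fin(1)] False less.prems by auto
    then obtain b where b: "b \<in> B" "b \<notin> A" by blast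
    \<comment> \<open>The swap trades an element of \<open>A - B\<close> for one of
      \<open>B - A\<close>: the weight stays \<open>w\<close> and \<open>card (A - B)\<close> drops,
      which drives the induction.\<close>
    let ?A = "insert b (A - {a})"
    have "?A - B = A - B - {a}" using a b by blast
    moreover have "card (A - B - {a}) < card (A - B)" using a fin by (intro card_Diff1_less) auto
    ultimately have "card (?A - B) < card (A - B)" by simp
    moreover have "?A \<subseteq> S" using less.prems b by blast
    moreover have "card ?A = w"
      using a b fin less.prems card_Suc_Diff1[OF fin(1) a(1)] by simp
    ultimately have "f ?A = f B" using less.hyps less.prems by blast
    moreover have "f ?A = f A" using swap a b less.prems by blast
    ultimately show ?thesis by simp
  qed
qed

text \<open>A monomial with both or neither of the variables a, b contributes equally to the two
  sums and cancels. Every other one loses exactly one variable, which is the drop in degree that the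
  reduction relies on; the sign records which variable was lost.\<close>

lemma swap_difference_expansion:
  fixes c :: "'m \<Rightarrow> real"
  assumes "finite M" "a \<noteq> b" "a \<notin> A" "b \<notin> A"
  shows "(\<Sum>m\<in>M. c m * of_bool (K m \<subseteq> insert a A)) - (\<Sum>m\<in>M. c m * of_bool (K m \<subseteq> insert b A))
    = (\<Sum>m\<in>{m \<in> M. (a \<in> K m) \<noteq> (b \<in> K m)}. (if a \<in> K m then c m else - c m) * of_bool (K m - {a, b} \<subseteq> A))"
proof -
  have "(\<Sum>m\<in>M. c m * of_bool (K m \<subseteq> insert a A)) - (\<Sum>m\<in>M. c m * of_bool (K m \<subseteq> insert b A))
     = (\<Sum>m\<in>M. c m * of_bool (K m \<subseteq> insert a A) - c m * of_bool (K m \<subseteq> insert b A))"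
    by (simp add: sum_subtractf)
  also have "\<dots> = (\<Sum>m\<in>{m \<in> M. (a \<in> K m) \<noteq> (b \<in> K m)}. (if a \<in> K m then c m else - c m) * of_bool (K m - {a, b} \<subseteq> A))"
  proof (rule sum.mono_neutral_cong_right)
    show "\<forall>m\<in>M - {m \<in> M. (a \<in> K m) \<noteq> (b \<in> K m)}.
        c m * of_bool (K m \<subseteq> insert a A) - c m * of_bool (K m \<subseteq> insert b A) = 0"
    proof
      fix m assume "m \<in> M - {m \<in> M. (a \<in> K m) \<noteq> (b \<in> K m)}"
      then have "K m \<subseteq> insert a A \<longleftrightarrow> K m \<subseteq> insert b A" using assms by blast
      then show "c m * of_bool (K m \<subseteq> insert a A) - c m * of_bool (K m \<subseteq> insert b A) = 0" by simp
    qed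
    fix m assume m: "m \<in> {m \<in> M. (a \<in> K m) \<noteq> (b \<in> K m)}"
    show "c m * of_bool (K m \<subseteq> insert a A) - c m * of_bool (K m \<subseteq> insert b A)
        = (if a \<in> K m then c m else - c m) * of_bool (K m - {a, b} \<subseteq> A)"
    proof (cases "a \<in> K m")
      case True
      then have "\<not> K m \<subseteq> insert b A" "K m \<subseteq> insert a A \<longleftrightarrow> K m - {a, b} \<subseteq> A" using m assms by blast+
      then show ?thesis using True by simp
    next
      case False
      then have "\<not> K m \<subseteq> insert a A" "K m \<subseteq> insert b A \<longleftrightarrow> K m - {a, b} \<subseteq> A" using m assms by blast+
      then show ?thesis using False by simp
    qed
  qed (use assms in auto)
  finally show ?thesis .
qed

text \<open>Induction on the ground set, with i counting the swap steps taken. Working with an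
  indexed expansion instead of a polynomial type lets the coordinate set shrink, and distinct
  indices may share the same \<open>K m\<close>, as x and x^2 do on the cube.\<close>

lemma univariate_witness:
  fixes c :: "'m \<Rightarrow> real" and S :: "'a set"
  assumes "finite S" "finite M" "\<And>m. m \<in> M \<Longrightarrow> K m \<subseteq> S" "\<And>m. m \<in> M \<Longrightarrow> card (K m) \<le> d"
    and "\<And>A. A \<subseteq> S \<Longrightarrow> f A = (\<Sum>m\<in>M. c m * of_bool (K m \<subseteq> A))"
    and "W \<subseteq> S" "f W \<noteq> 0"
  shows "\<exists>i q. i \<le> d \<and> i \<le> card W \<and> card W + i \<le> card S \<and> degree q \<le> d - i \<and> poly q (real (card W)) \<noteq> 0 \<and>
    (\<forall>j. i \<le> j \<and> j + i \<le> card S \<and> (\<forall>A. A \<subseteq> S \<and> card A = j \<longrightarrow> f A = 0) \<longrightarrow> poly q (real j) = 0)"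
  using assms
proof (induction "card S" arbitrary: S M K d f c W rule: less_induct)
  case less
  note fS = less.prems(1) and fM = less.prems(2) and f = less.prems(5)
  define w where "w = card W"
  have wS: "w \<le> card S" using less.prems by (simp add: w_def card_mono)
  obtain q where q: "degree q \<le> d"
    "\<And>j. j \<le> card S \<Longrightarrow> (\<Sum>A | A \<subseteq> S \<and> card A = j. f A) = real (card S choose j) * poly q (real j)"
  proof -
    obtain q where "degree q \<le> d" and q: "\<forall>j\<le>card S.
      (\<Sum>A | A \<subseteq> S \<and> card A = j. \<Sum>m\<in>M. c m * of_bool (K m \<subseteq> A)) = real (card S choose j) * poly q (real j)"
      using layer_sum_poly[where c = c and K = K, OF less.prems(1-4)] by blast
    moreover have "(\<Sum>A | A \<subseteq> S \<and> card A = j. \<Sum>m\<in>M. c m * of_bool (K m \<subseteq> A)) = (\<Sum>A | A \<subseteq> S \<and> card A = j. f A)" for j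
      by (intro sum.cong refl) (simp add: f)
    ultimately show ?thesis using that by simp
  qed
  show ?case
  proof (cases "(\<Sum>A | A \<subseteq> S \<and> card A = w. f A) = 0")
    case False
    have "poly q (real j) = 0" if "j \<le> card S" "\<forall>A. A \<subseteq> S \<and> card A = j \<longrightarrow> f A = 0" for j
    proof -
      have "(\<Sum>A | A \<subseteq> S \<and> card A = j. f A) = 0" using that by (intro sum.neutral) auto
      then show ?thesis using q(2)[OF that(1)] that(1) by (simp add: binomial_eq_0_iff)
    qed
    moreover have "poly q (real w) \<noteq> 0" using False q(2)[OF wS] by auto
    ultimately show ?thesis using q(1) wS by (intro exI[of _ 0] exI[of _ q]) (auto simp: w_def)
  next
    case True
    \<comment> \<open>Otherwise f is constant on layer w, and its sum there is (|S| choose w) times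
      the nonzero value \<open>f W\<close>.\<close>
    have "\<exists>A a b. A \<subseteq> S \<and> card A = w \<and> a \<in> A \<and> b \<in> S - A \<and> f (insert b (A - {a})) \<noteq> f A"
    proof (rule ccontr)
      assume neg: "\<not> ?thesis"
      have "f A = f W" if "A \<subseteq> S" "card A = w" for A
      proof (rule constant_on_layer_if_swap_invariant[where w = w and f = f, OF fS _ that less.prems(6)])
        show "f (insert b (A - {a})) = f A" if "A \<subseteq> S" "card A = w" "a \<in> A" "b \<in> S - A" for A a b
          using neg that by metis
      qed (simp add: w_def)
      then have "(\<Sum>A | A \<subseteq> S \<and> card A = w. f A) = (\<Sum>A | A \<subseteq> S \<and> card A = w. f W)"
        by (intro sum.cong) auto
      also have "\<dots> = real (card S choose w) * f W" using n_subsets[OF fS] by simp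
      finally show False using True wS less.prems(7) by (simp add: binomial_eq_0_iff)
    qed
    then obtain A a b where A: "A \<subseteq> S" "card A = w" "a \<in> A" "b \<in> S - A" "f (insert b (A - {a})) \<noteq> f A"
      by blast
    define S' M' K' c' where "S' = S - {a, b}" and "M' = {m \<in> M. (a \<in> K m) \<noteq> (b \<in> K m)}"
      and "K' = (\<lambda>m. K m - {a, b})" and "c' = (\<lambda>m. if a \<in> K m then c m else - c m)"
    \<comment> \<open>\<open>g (A - {a})\<close> equals \<open>f A - f (insert b (A - {a}))\<close>,
      so \<open>A - {a}\<close> takes over the role of \<open>W\<close> in the recursive
      call.\<close>
    define g where "g B = f (insert a B) - f (insert b B)" for B
    have ab: "a \<noteq> b" "a \<in> S" "b \<in> S" using A by auto
    have cS': "card S' + 2 = card S"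
    proof -
      have "card S' = card S - 2" using fS ab unfolding S'_def by (subst card_Diff_subset) auto
      moreover have "card {a, b} \<le> card S" using fS ab by (intro card_mono) auto
      ultimately show ?thesis using ab by simp
    qed
    have fA: "finite A" using A fS finite_subset by blast
    have cA: "Suc (card (A - {a})) = w" using A(2,3) fA by (metis card_Suc_Diff1)
    have g: "g B = (\<Sum>m\<in>M'. c' m * of_bool (K' m \<subseteq> B))" if "B \<subseteq> S'" for B
    proof -
      have *: "insert a B \<subseteq> S" "insert b B \<subseteq> S" "a \<notin> B" "b \<notin> B" using that ab S'_def by auto
      show ?thesis
        unfolding g_def f[OF *(1)] f[OF *(2)] M'_def K'_def c'_def
        by (rule swap_difference_expansion[OF fM ab(1) *(3,4)])
    qed
    have K'd: "card (K' m) \<le> d - 1 \<and> d \<ge> 1" if "m \<in> M'" for m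
    proof -
      have m: "m \<in> M" "(a \<in> K m) \<noteq> (b \<in> K m)" using that M'_def by auto
      have fin: "finite (K m)" using less.prems(3)[OF m(1)] fS finite_subset by blast
      have "K' m \<subset> K m" using m(2) K'_def by auto
      then have "card (K' m) < card (K m)" using fin psubset_card_mono by blast
      then show ?thesis using less.prems(4)[OF m(1)] by linarith
    qed
    have gne: "g (A - {a}) \<noteq> 0" using A(3,5) by (simp add: g_def insert_absorb)
    have AS': "A - {a} \<subseteq> S'" using A S'_def by auto
    \<comment> \<open>A nonzero value of g requires some term, and a term of \<open>M'\<close>
      contains a variable; hence \<open>d - 1\<close> does not truncate.\<close>
    have "M' \<noteq> {}" using gne g[OF AS'] by auto
    then have d: "d \<ge> 1" using K'd by blast
    have "\<exists>i q. i \<le> d - 1 \<and> i \<le> card (A - {a}) \<and> card (A - {a}) + i \<le> card S' \<and> degree q \<le> d - 1 - i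
      \<and> poly q (real (card (A - {a}))) \<noteq> 0 \<and>
      (\<forall>j. i \<le> j \<and> j + i \<le> card S' \<and> (\<forall>B. B \<subseteq> S' \<and> card B = j \<longrightarrow> g B = 0) \<longrightarrow> poly q (real j) = 0)"
    proof (rule less.hyps[of S' M' K' "d - 1" g c' "A - {a}"])
      show "K' m \<subseteq> S'" if "m \<in> M'" for m
        using that less.prems(3) unfolding K'_def S'_def M'_def by blast
    qed (use cS' fS fM K'd g AS' gne in \<open>auto simp: S'_def M'_def\<close>)
    then obtain i q where iq: "i \<le> d - 1" "i \<le> card (A - {a})" "card (A - {a}) + i \<le> card S'" "degree q \<le> d - 1 - i"
      "poly q (real (card (A - {a}))) \<noteq> 0"
      "\<And>j. i \<le> j \<Longrightarrow> j + i \<le> card S' \<Longrightarrow> (\<And>B. B \<subseteq> S' \<Longrightarrow> card B = j \<Longrightarrow> g B = 0) \<Longrightarrow> poly q (real j) = 0"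
      by blast
    \<comment> \<open>Weight \<open>k\<close> on \<open>S - {a, b}\<close> is weight \<open>k + 1\<close> on \<open>S\<close>, whence the shift.\<close>
    define r where "r = q \<circ>\<^sub>p [:-1, 1:]"
    have r: "poly r (real (Suc k)) = poly q (real k)" for k by (simp add: r_def poly_pcompose)
    have "degree r \<le> d - Suc i" using iq(4) by (simp add: r_def degree_pcompose)
    moreover have "poly r (real w) \<noteq> 0" unfolding cA[symmetric] r by (rule iq(5))
    moreover have "poly r (real j) = 0"
      if j: "Suc i \<le> j" "j + Suc i \<le> card S" "\<forall>A. A \<subseteq> S \<and> card A = j \<longrightarrow> f A = 0" for j
    proof -
      obtain k where k: "j = Suc k" using j(1) by (cases j) auto
      have "poly q (real k) = 0"
      proof (rule iq(6))
        fix B assume B: "B \<subseteq> S'" "card B = k"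
        have "finite B" "a \<notin> B" "b \<notin> B" using B fS S'_def finite_subset by auto
        then have "card (insert a B) = j" "card (insert b B) = j" "insert a B \<subseteq> S" "insert b B \<subseteq> S"
          using B k ab S'_def by auto
        then show "g B = 0" using j(3) g_def by simp
      qed (use j k cS' in auto)
      then show ?thesis using r k by simp
    qed
    \<comment> \<open>Passing to \<open>A - {a}\<close> inside \<open>S'\<close> lowers the weight
      and the number of zeros by one each, so both bounds on i hold for \<open>Suc i\<close>
      upstairs.\<close>
    moreover have "Suc i \<le> d" "Suc i \<le> w" "w + Suc i \<le> card S" using iq d cA cS' by auto
    ultimately show ?thesis unfolding w_def by blast
  qed
qed

section \<open>Evaluation and degree of multivariate polynomials\<close>

lemma mpoly_eval_add: "mpoly_eval (P + Q) x = mpoly_eval P x + mpoly_eval Q x"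
  unfolding mpoly_eval_def by (rule setsum_keys_plus_distrib) (auto simp: distrib_right)

lemma mpoly_eval_sum: "mpoly_eval (sum P I) x = (\<Sum>i\<in>I. mpoly_eval (P i) x)"
proof (induction I rule: infinite_finite_induct)
  case (insert i I)
  then show ?case by (simp add: mpoly_eval_add)
qed (auto simp: mpoly_eval_def)

lemma mpoly_eval_single:
  "mpoly_eval (Poly_Mapping.single m c) x = c * (\<Prod>i\<in>UNIV. (x $ i) ^ Poly_Mapping.lookup m i)"
  by (simp add: mpoly_eval_def)

lemma poly_mapping_sum_single:
  "(\<Sum>m\<in>Poly_Mapping.keys P. Poly_Mapping.single m (Poly_Mapping.lookup P m)) = P"
proof (rule poly_mapping_eqI)
  fix k
  show "Poly_Mapping.lookup (\<Sum>m\<in>Poly_Mapping.keys P. Poly_Mapping.single m (Poly_Mapping.lookup P m)) k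
      = Poly_Mapping.lookup P k"
    by (simp add: lookup_sum lookup_single when_def in_keys_iff)
qed

text \<open>Both factors are split into single terms, for which multiplicativity is just addition of
  exponents.\<close>

lemma mpoly_eval_mult: "mpoly_eval (P * Q) x = mpoly_eval P x * mpoly_eval Q x"
proof -
  let ?s = "\<lambda>P m. Poly_Mapping.single m (Poly_Mapping.lookup P m)"
  have single: "mpoly_eval (?s P m * ?s Q k) x = mpoly_eval (?s P m) x * mpoly_eval (?s Q k) x" for m k
    by (simp add: mult_single mpoly_eval_single lookup_add power_add prod.distrib)
  have "P * Q = (\<Sum>m\<in>Poly_Mapping.keys P. ?s P m) * (\<Sum>k\<in>Poly_Mapping.keys Q. ?s Q k)"
    by (simp only: poly_mapping_sum_single)
  also have "\<dots> = (\<Sum>m\<in>Poly_Mapping.keys P. \<Sum>k\<in>Poly_Mapping.keys Q. ?s P m * ?s Q k)"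
    by (rule sum_product)
  finally have "mpoly_eval (P * Q) x
      = (\<Sum>m\<in>Poly_Mapping.keys P. \<Sum>k\<in>Poly_Mapping.keys Q. mpoly_eval (?s P m) x * mpoly_eval (?s Q k) x)"
    by (simp add: mpoly_eval_sum single)
  also have "\<dots> = (\<Sum>m\<in>Poly_Mapping.keys P. mpoly_eval (?s P m) x) * (\<Sum>k\<in>Poly_Mapping.keys Q. mpoly_eval (?s Q k) x)"
    by (rule sum_product[symmetric])
  also have "\<dots> = mpoly_eval P x * mpoly_eval Q x"
    by (simp only: mpoly_eval_sum[symmetric] poly_mapping_sum_single)
  finally show ?thesis .
qed

lemma mpoly_degree_le_iff:
  "mpoly_degree P \<le> d \<longleftrightarrow> (\<forall>m\<in>Poly_Mapping.keys P. (\<Sum>i\<in>UNIV. Poly_Mapping.lookup m i) \<le> d)"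
  unfolding mpoly_degree_def by (subst Max_le_iff) auto

lemma mpoly_degree_mult_le:
  assumes "mpoly_degree P \<le> d" "mpoly_degree Q \<le> e"
  shows "mpoly_degree (P * Q) \<le> d + e"
  unfolding mpoly_degree_le_iff
proof
  fix m assume "m \<in> Poly_Mapping.keys (P * Q)"
  then obtain a b where m: "m = a + b" "a \<in> Poly_Mapping.keys P" "b \<in> Poly_Mapping.keys Q"
    using keys_mult[of P Q] by blast
  have "(\<Sum>i\<in>UNIV. Poly_Mapping.lookup a i) + (\<Sum>i\<in>UNIV. Poly_Mapping.lookup b i) \<le> d + e"
    using assms m(2,3) unfolding mpoly_degree_le_iff by (intro add_mono) auto
  then show "(\<Sum>i\<in>UNIV. Poly_Mapping.lookup m i) \<le> d + e"
    by (simp add: m(1) lookup_add sum.distrib)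
qed

lemma mpoly_degree_add_le:
  "mpoly_degree P \<le> d \<Longrightarrow> mpoly_degree Q \<le> d \<Longrightarrow> mpoly_degree (P + Q) \<le> d"
  using keys_add[of P Q] unfolding mpoly_degree_le_iff by blast

lemma mpoly_degree_sum_le:
  assumes "\<And>i. i \<in> I \<Longrightarrow> mpoly_degree (P i) \<le> d"
  shows "mpoly_degree (sum P I) \<le> d"
proof -
  have "Poly_Mapping.keys (sum P I) \<subseteq> (\<Union>i\<in>I. Poly_Mapping.keys (P i))"
  proof
    fix m assume "m \<in> Poly_Mapping.keys (sum P I)"
    then have "(\<Sum>i\<in>I. Poly_Mapping.lookup (P i) m) \<noteq> 0"
      by (simp add: in_keys_iff lookup_sum)
    then obtain i where "i \<in> I" "Poly_Mapping.lookup (P i) m \<noteq> 0"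
      by (meson sum.not_neutral_contains_not_neutral)
    then show "m \<in> (\<Union>i\<in>I. Poly_Mapping.keys (P i))" by (auto simp: in_keys_iff)
  qed
  then show ?thesis using assms unfolding mpoly_degree_le_iff by blast
qed

lemma mpoly_degree_single_le: "mpoly_degree (Poly_Mapping.single m c) \<le> (\<Sum>i\<in>UNIV. Poly_Mapping.lookup m i)"
  unfolding mpoly_degree_le_iff by simp

section \<open>From hyperplane covers to polynomial covers\<close>

lemma hyperplane_as_mpoly_zeros:
  fixes H :: "(real ^ 'n::finite) set"
  assumes "hyperplane H"
  obtains P :: "'n real_mpoly" where "mpoly_degree P \<le> 1" "\<And>x. mpoly_eval P x = 0 \<longleftrightarrow> x \<in> H"
proof -
  obtain a b where H: "H = {x. a \<bullet> x = b}" using assms unfolding hyperplane_def by blast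
  let ?X = "\<lambda>i. Poly_Mapping.single i (1::nat)"
  define L :: "'n real_mpoly" where
    "L = (\<Sum>i\<in>UNIV. Poly_Mapping.single (?X i) (a $ i))"
  define P :: "'n real_mpoly" where
    "P = L + Poly_Mapping.single 0 (- b)"
  have X: "(\<Sum>k\<in>UNIV. Poly_Mapping.lookup (?X i) k) = 1" for i :: 'n
    by (simp add: lookup_single when_def)
  have "mpoly_degree (Poly_Mapping.single (?X i) (a $ i)) \<le> 1" for i
    using mpoly_degree_single_le[of "?X i" "a $ i"] unfolding X .
  then have "mpoly_degree L \<le> 1" unfolding L_def by (rule mpoly_degree_sum_le)
  moreover have "mpoly_degree (Poly_Mapping.single 0 (- b) :: 'n real_mpoly) \<le> 1"
    by (rule order.trans[OF mpoly_degree_single_le]) simp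
  ultimately have "mpoly_degree P \<le> 1" unfolding P_def by (rule mpoly_degree_add_le)
  moreover have "mpoly_eval P x = a \<bullet> x - b" for x
  proof -
    have X: "(\<Prod>k\<in>UNIV. (x $ k) ^ Poly_Mapping.lookup (?X i) k) = x $ i" for i
    proof -
      have "(\<Prod>k\<in>UNIV. (x $ k) ^ Poly_Mapping.lookup (?X i) k) = (\<Prod>k\<in>UNIV. if k = i then x $ k else 1)"
        by (intro prod.cong) (auto simp: lookup_single when_def)
      then show ?thesis by simp
    qed
    have "mpoly_eval P x = mpoly_eval L x + mpoly_eval (Poly_Mapping.single 0 (- b)) x"
      unfolding P_def by (rule mpoly_eval_add)
    also have "\<dots> = a \<bullet> x - b"
      by (simp only: L_def mpoly_eval_sum mpoly_eval_single X inner_vec_def) simp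
    finally show ?thesis .
  qed
  ultimately show ?thesis using that H by auto
qed

text \<open>Multiply the affine linear equations; the empty family gives the constant 1. This is
  what bounds the polynomial minima by the hyperplane minima.\<close>

lemma hyperplane_union_as_mpoly_zeros:
  fixes \<H> :: "(real ^ 'n::finite) set set"
  assumes "finite \<H>" "\<forall>H\<in>\<H>. hyperplane H"
  shows "\<exists>P :: 'n real_mpoly. mpoly_degree P \<le> card \<H> \<and> (\<forall>x. mpoly_eval P x = 0 \<longleftrightarrow> x \<in> \<Union>\<H>)"
  using assms
proof (induction \<H>)
  case empty
  have "mpoly_degree (Poly_Mapping.single 0 1 :: 'n real_mpoly) \<le> 0"
    using mpoly_degree_single_le[of 0 "1::real"] by simp
  moreover have "mpoly_eval (Poly_Mapping.single 0 1 :: 'n real_mpoly) x \<noteq> 0" for x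
    unfolding mpoly_eval_single by simp
  ultimately show ?case by auto
next
  case (insert H \<H>)
  then obtain P :: "'n real_mpoly" where P: "mpoly_degree P \<le> card \<H>" "\<And>x. mpoly_eval P x = 0 \<longleftrightarrow> x \<in> \<Union>\<H>"
    by auto
  obtain Q :: "'n real_mpoly" where Q: "mpoly_degree Q \<le> 1" "\<And>x. mpoly_eval Q x = 0 \<longleftrightarrow> x \<in> H"
    using hyperplane_as_mpoly_zeros insert.prems by blast
  have "mpoly_degree (Q * P) \<le> card (insert H \<H>)"
    using mpoly_degree_mult_le[OF Q(1) P(1)] insert.hyps by simp
  moreover have "mpoly_eval (Q * P) x = 0 \<longleftrightarrow> x \<in> \<Union>(insert H \<H>)" for x
    using P(2) Q(2) by (simp add: mpoly_eval_mult)
  ultimately show ?case by blast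
qed

section \<open>Cube points as subsets of the coordinates\<close>

definition cube_point :: "'n::finite set \<Rightarrow> real ^ 'n" where
  "cube_point A = (\<chi> i. of_bool (i \<in> A))"

lemma cube_point_nth [simp]: "cube_point A $ i = of_bool (i \<in> A)"
  by (simp add: cube_point_def)

lemma cube_point_in_cube [simp]: "cube_point A \<in> cube"
  by (simp add: cube_def)

lemma hamming_weight_cube_point [simp]: "hamming_weight (cube_point A) = card A"
  by (simp add: hamming_weight_def)

lemma in_cubeE:
  assumes "x \<in> cube"
  obtains A where "x = cube_point A"
proof
  show "x = cube_point {i. x $ i \<noteq> 0}"
    using assms by (auto simp: vec_eq_iff cube_def)
qed

lemma cube_point_in_layers [simp]: "cube_point A \<in> layers F \<longleftrightarrow> card A \<in> F"
  by (simp add: layers_def)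

text \<open>On 0/1 values only the support of a monomial matters: a positive exponent changes
  nothing, and \<open>0 ^ 0 = 1\<close> makes absent variables harmless. This supplies the expansion
  required by \<open>univariate_witness\<close>.\<close>

lemma mpoly_eval_cube_point:
  "mpoly_eval P (cube_point A)
    = (\<Sum>m\<in>Poly_Mapping.keys P. Poly_Mapping.lookup P m * of_bool (Poly_Mapping.keys m \<subseteq> A))"
proof -
  have "(\<Prod>i\<in>UNIV. (of_bool (i \<in> A) :: real) ^ Poly_Mapping.lookup m i) = of_bool (Poly_Mapping.keys m \<subseteq> A)" for m
  proof (cases "Poly_Mapping.keys m \<subseteq> A")
    case True
    then have "(of_bool (i \<in> A) :: real) ^ Poly_Mapping.lookup m i = 1" for i
      by (cases "i \<in> A") (use in_keys_iff[of i m] in auto)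
    then show ?thesis using True by simp
  next
    case False
    then obtain i where "i \<notin> A" "Poly_Mapping.lookup m i \<noteq> 0" by (auto simp: in_keys_iff)
    then have "\<exists>i\<in>UNIV. (of_bool (i \<in> A) :: real) ^ Poly_Mapping.lookup m i = 0" by (intro bexI[of _ i]) auto
    then show ?thesis using False by (simp add: prod_zero_iff)
  qed
  then show ?thesis by (simp add: mpoly_eval_def)
qed

section \<open>The sets \<open>T n i\<close> and the two lower bounds on degrees\<close>

lemma T_subset: "i \<le> n \<Longrightarrow> T n i \<subseteq> {0..n}"
  by (auto simp: T_def)

lemma T_mono: "i \<le> k \<Longrightarrow> T n i \<subseteq> T n k"
  by (auto simp: T_def)

lemma card_T: "2 * i \<le> n \<Longrightarrow> card (T n i) = 2 * i"
  unfolding T_def by (subst card_Un_disjoint) auto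

text \<open>The complement of \<open>T CARD('n) i\<close> in [0, n] is the window [i, n - i], so
  each element of E outside it is a root of the univariate witness. That polynomial is nonzero, and
  its degree bounds their number.\<close>

lemma mpoly_univariate_witness:
  fixes P :: "'n::finite real_mpoly"
  assumes "layers E \<subseteq> cube_zeros P" "E \<subseteq> {0..CARD('n)}"
    and "mpoly_eval P (cube_point W) \<noteq> 0"
  obtains i where "i \<le> mpoly_degree P" "i \<le> card W" "card W + i \<le> CARD('n)" "card W \<notin> E"
    "card (E - T CARD('n) i) \<le> mpoly_degree P - i"
proof -
  have vanish: "mpoly_eval P (cube_point A) = 0" if "card A \<in> E" for A
  proof -
    have "cube_point A \<in> cube_zeros P" using assms(1) that cube_point_in_layers by blast
    then show ?thesis by (simp add: cube_zeros_def)
  qed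
  have "\<exists>i q. i \<le> mpoly_degree P \<and> i \<le> card W \<and> card W + i \<le> CARD('n) \<and> degree q \<le> mpoly_degree P - i
    \<and> poly q (real (card W)) \<noteq> 0 \<and>
    (\<forall>j. i \<le> j \<and> j + i \<le> CARD('n) \<and> (\<forall>A. A \<subseteq> UNIV \<and> card A = j \<longrightarrow> mpoly_eval P (cube_point A) = 0)
      \<longrightarrow> poly q (real j) = 0)"
  proof (rule univariate_witness)
    fix m assume m: "m \<in> Poly_Mapping.keys P"
    have "card (Poly_Mapping.keys m) = (\<Sum>i\<in>Poly_Mapping.keys m. 1)" by simp
    also have "\<dots> \<le> (\<Sum>i\<in>Poly_Mapping.keys m. Poly_Mapping.lookup m i)"
      by (intro sum_mono) (simp add: in_keys_iff)
    also have "\<dots> \<le> (\<Sum>i\<in>UNIV. Poly_Mapping.lookup m i)" by (intro sum_mono2) auto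
    also have "\<dots> \<le> mpoly_degree P" using m mpoly_degree_le_iff by blast
    finally show "card (Poly_Mapping.keys m) \<le> mpoly_degree P" .
  qed (use assms(3) in \<open>auto simp: mpoly_eval_cube_point\<close>)
  then obtain i q where i: "i \<le> mpoly_degree P" "i \<le> card W" "card W + i \<le> CARD('n)"
    and q: "degree q \<le> mpoly_degree P - i" "poly q (real (card W)) \<noteq> 0"
    "\<And>j. i \<le> j \<Longrightarrow> j + i \<le> CARD('n) \<Longrightarrow> (\<And>A :: 'n set. card A = j \<Longrightarrow> mpoly_eval P (cube_point A) = 0)
      \<Longrightarrow> poly q (real j) = 0"
    by blast
  have "real ` (E - T CARD('n) i) \<subseteq> {x. poly q x = 0}"
  proof
    fix x assume "x \<in> real ` (E - T CARD('n) i)"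
    then obtain j where j: "x = real j" "j \<in> E" "j \<notin> T CARD('n) i" by blast
    then have "j \<le> CARD('n)" using assms(2) by auto
    then have "i \<le> j" "j + i \<le> CARD('n)" using j(3) i by (auto simp: T_def)
    then show "x \<in> {x. poly q x = 0}" using q(3) vanish j by auto
  qed
  moreover have "q \<noteq> 0" using q(2) by auto
  ultimately have "card (real ` (E - T CARD('n) i)) \<le> card {x. poly q x = 0}"
    by (intro card_mono poly_roots_finite)
  also have "\<dots> \<le> degree q" using \<open>q \<noteq> 0\<close> by (rule card_poly_roots_bound)
  finally have "card (E - T CARD('n) i) \<le> mpoly_degree P - i"
    using q(1) by (simp add: card_image)
  moreover have "card W \<notin> E" using vanish assms(3) by blast
  ultimately show ?thesis using that i by blast
qed

text \<open>The weight of a point where P does not vanish lies in the window [i, n - i] and not in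
  E, so E and \<open>T CARD('n) i\<close> together miss it.\<close>

lemma nontrivial_cover_imp_admitting:
  fixes P :: "'n::finite real_mpoly"
  assumes "nontrivial_polynomial_cover E P" "E \<subseteq> {0..CARD('n)}"
  shows "admitting CARD('n) (mpoly_degree P) E"
proof -
  have sub: "layers E \<subseteq> cube_zeros P" and "cube_zeros P \<noteq> cube"
    using assms(1) by (auto simp: nontrivial_polynomial_cover_def)
  then obtain x where "x \<in> cube" "mpoly_eval P x \<noteq> 0" by (auto simp: cube_zeros_def)
  then obtain W where "mpoly_eval P (cube_point W) \<noteq> 0" by (auto elim: in_cubeE)
  from mpoly_univariate_witness[OF sub assms(2) this]
  obtain i where i: "i \<le> mpoly_degree P" "i \<le> card W" "card W + i \<le> CARD('n)" "card W \<notin> E"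
    "card (E - T CARD('n) i) \<le> mpoly_degree P - i" .
  have "card W \<notin> E \<union> T CARD('n) i" "card W \<le> CARD('n)" using i by (auto simp: T_def)
  then have "E \<union> T CARD('n) i \<noteq> {0..CARD('n)}" by (metis atLeastAtMost_iff zero_le)
  then show ?thesis using i(1,5) unfolding admitting_def admitting_at_def by (intro bexI[of _ i]) auto
qed

text \<open>For i \<le> k the set \<open>T CARD('n) i\<close> lies in E and has 2i elements, so the
  root count reads |E| - 2i \<le> deg P - i, that is |E| \<le> deg P + i \<le> deg P + k.\<close>

lemma proper_cover_degree_ge:
  fixes P :: "'n::finite real_mpoly"
  assumes "proper_polynomial_cover E P" "E \<subset> {0..CARD('n)}"
    and k: "T CARD('n) k \<subseteq> E" "2 * k \<le> CARD('n)"
    and max: "\<And>i. 2 * i \<le> CARD('n) \<Longrightarrow> T CARD('n) i \<subseteq> E \<Longrightarrow> i \<le> k"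
  shows "card E \<le> mpoly_degree P + k"
proof -
  let ?n = "CARD('n)"
  have sub: "layers E \<subseteq> cube_zeros P" and nz: "\<And>j. j \<le> ?n \<Longrightarrow> j \<notin> E \<Longrightarrow> \<not> layers {j} \<subseteq> cube_zeros P"
    using assms(1) by (auto simp: proper_polynomial_cover_def)
  \<comment> \<open>A polynomial nonzero on layer \<open>k\<close> or \<open>n - k\<close> forces \<open>i \<le> k\<close> in the witness below.\<close>
  have "k \<notin> E \<or> ?n - k \<notin> E"
  proof (rule ccontr)
    assume "\<not> ?thesis"
    then have sub': "T ?n k \<union> {k, ?n - k} \<subseteq> E" using k by auto
    \<comment> \<open>If 2(k + 1) \<le> n, the two extra weights put \<open>T ?n (Suc k)\<close>
      inside E, against the maximality of k. Otherwise n is 2k or 2k + 1, the window [k, n - k]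
      consists of its endpoints, and E would be all of [0, n].\<close>
    show False
    proof (cases "2 * Suc k \<le> ?n")
      case True
      have "x \<in> T ?n k \<union> {k, ?n - k}" if "x \<in> T ?n (Suc k)" for x
        using that True by (auto simp: T_def)
      then show False using max[OF True] sub' by fastforce
    next
      case False
      have "x \<in> T ?n k \<union> {k, ?n - k}" if "x \<le> ?n" for x
        using that False k(2) by (auto simp: T_def)
      then show False using sub' assms(2) by fastforce
    qed
  qed
  then obtain j where j: "j \<notin> E" "j = k \<or> j = ?n - k" by auto
  then have "j \<le> ?n" using k by auto
  then obtain x where x: "x \<in> layers {j}" "x \<notin> cube_zeros P" using nz j(1) by blast
  then obtain W where W: "card W = j" "mpoly_eval P (cube_point W) \<noteq> 0"
    by (auto simp: layers_def cube_zeros_def elim!: in_cubeE)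
  from mpoly_univariate_witness[OF sub _ W(2)] assms(2)
  obtain i where i: "i \<le> mpoly_degree P" "i \<le> card W" "card W + i \<le> ?n"
    "card (E - T ?n i) \<le> mpoly_degree P - i" by (metis psubsetE)
  have ik: "i \<le> k" using i W j(2) k(2) by linarith
  have "card (E - T ?n i) = card E - 2 * i"
  proof -
    have "T ?n i \<subseteq> E" using T_mono[OF ik] k(1) by blast
    moreover have "finite E" using assms(2) finite_subset by blast
    ultimately show ?thesis using card_T[of i ?n] ik k(2) finite_subset by (subst card_Diff_subset) auto
  qed
  then show ?thesis using i(1,4) ik by linarith
qed

section \<open>Hyperplane constructions for the upper bounds\<close>

lemma balanced_hyperplane_family:
  fixes F :: "nat set"
  assumes "2 * i \<le> CARD('n)" "finite F"
  obtains \<H> :: "(real ^ 'n::finite) set set" where "finite \<H>" "card \<H> \<le> i + card F" "\<forall>H\<in>\<H>. hyperplane H"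
    "layers (F \<union> T CARD('n) i) \<subseteq> \<Union>\<H>"
    "\<forall>j\<in>{0..CARD('n)} - (F \<union> T CARD('n) i). \<not> layers {j} \<subseteq> \<Union>\<H>"
proof -
  let ?n = "CARD('n)"
  obtain e :: "nat \<Rightarrow> 'n" where e: "bij_betw e {0..<?n} UNIV"
    using ex_bij_betw_nat_finite[of "UNIV :: 'n set"] by auto
  have e_eq: "e k = e l \<longleftrightarrow> k = l" if "k < ?n" "l < ?n" for k l
    using bij_betw_imp_inj_on[OF e] that by (auto simp: inj_on_def)
  \<comment> \<open>Since 2i \<le> n, the enumeration \<open>e\<close> provides i disjoint pairs of
    coordinates. A cube point is off \<open>pair k\<close> exactly if it has a single one in the
    k-th pair.\<close>
  define pair where "pair k = {x :: real ^ 'n. (axis (e (2 * k)) 1 - axis (e (2 * k + 1)) 1) \<bullet> x = 0}" for k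
  define level where "level j = {x :: real ^ 'n. (\<chi> i. 1) \<bullet> x = real j}" for j :: nat
  define \<H> where "\<H> = pair ` {..<i} \<union> level ` F"
  have pair: "cube_point A \<in> pair k \<longleftrightarrow> (e (2 * k) \<in> A \<longleftrightarrow> e (2 * k + 1) \<in> A)" for A k
    by (simp add: pair_def inner_diff_left inner_axis')
  have level: "cube_point A \<in> level j \<longleftrightarrow> card A = j" for A j
    by (simp add: level_def inner_vec_def)
  show ?thesis
  proof
    show "finite \<H>" using assms by (simp add: \<H>_def)
    have "card \<H> \<le> card (pair ` {..<i}) + card (level ` F)" unfolding \<H>_def by (rule card_Un_le)
    also have "\<dots> \<le> i + card F"
      using card_image_le[of "{..<i}" pair] card_image_le[OF assms(2), of level] by simp
    finally show "card \<H> \<le> i + card F" .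
    have "hyperplane (pair k)" if "k < i" for k
    proof -
      have "e (2 * k) \<noteq> e (2 * k + 1)" using that assms(1) by (subst e_eq) auto
      then have "(axis (e (2 * k)) 1 - axis (e (2 * k + 1)) 1 :: real ^ 'n) \<noteq> 0"
        by (auto simp: axis_eq_axis)
      then show ?thesis unfolding pair_def hyperplane_def by blast
    qed
    moreover have "hyperplane (level j)" for j
    proof -
      have "(\<chi> i. 1 :: real ^ 'n) \<noteq> 0" by (simp add: vec_eq_iff)
      then show ?thesis unfolding level_def hyperplane_def by blast
    qed
    ultimately show "\<forall>H\<in>\<H>. hyperplane H" by (auto simp: \<H>_def)
    show "layers (F \<union> T ?n i) \<subseteq> \<Union>\<H>"
    proof
      fix x :: "real ^ 'n" assume x: "x \<in> layers (F \<union> T ?n i)"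
      then obtain A where A: "x = cube_point A" by (auto simp: layers_def elim: in_cubeE)
      show "x \<in> \<Union>\<H>"
      proof (rule ccontr)
        assume n: "x \<notin> \<Union>\<H>"
        then have "card A \<notin> F" using level A by (auto simp: \<H>_def)
        then have cT: "card A \<in> T ?n i" using x A by simp
        have *: "(e (2 * k) \<in> A) \<noteq> (e (2 * k + 1) \<in> A)" if "k < i" for k
          using n pair A that by (auto simp: \<H>_def)
        \<comment> \<open>\<open>t k\<close> indexes the member of the k-th pair that lies in B, and
          k is recovered as \<open>t k div 2\<close>. Applied to A and to its complement, this gives
          i \<le> |A| \<le> n - i, so |A| is not in \<open>T ?n i\<close>.\<close>
        have many: "i \<le> card B" if B: "\<And>k. k < i \<Longrightarrow> (e (2 * k) \<in> B) \<noteq> (e (2 * k + 1) \<in> B)" for B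
        proof -
          define t where "t k = 2 * k + of_bool (e (2 * k) \<notin> B)" for k
          have t: "t k div 2 = k" "t k < 2 * k + 2" for k by (auto simp: t_def)
          have "inj_on (\<lambda>k. e (t k)) {..<i}"
          proof (rule inj_onI)
            fix k l assume kl: "k \<in> {..<i}" "l \<in> {..<i}" "e (t k) = e (t l)"
            have "t k < ?n" "t l < ?n" using t(2)[of k] t(2)[of l] kl(1,2) assms(1) by auto
            then have "t k = t l" using kl(3) e_eq by blast
            then show "k = l" using t(1) by metis
          qed
          moreover have "(\<lambda>k. e (t k)) ` {..<i} \<subseteq> B" using B by (auto simp: t_def)
          ultimately have "card {..<i} \<le> card B" by (intro card_inj_on_le) auto
          then show ?thesis by simp
        qed
        have "i \<le> card A" using * by (rule many)
        moreover have "i \<le> card (- A)" using * by (intro many) auto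
        moreover have "card (- A) = ?n - card A" by (simp add: Compl_eq_Diff_UNIV card_Diff_subset)
        moreover have "card A \<le> ?n" by (simp add: card_mono)
        ultimately show False using cT assms(1) by (auto simp: T_def)
      qed
    qed
    show "\<forall>j\<in>{0..?n} - (F \<union> T ?n i). \<not> layers {j} \<subseteq> \<Union>\<H>"
    proof
      fix j assume "j \<in> {0..?n} - (F \<union> T ?n i)"
      then have j: "j \<le> ?n" "j \<notin> F \<union> T ?n i" by auto
      then have ij: "i \<le> j" "i + j \<le> ?n" using assms(1) by (auto simp: T_def)
      \<comment> \<open>An uncovered point of weight j: one coordinate from each pair, then j - i
        further ones beyond the pairs, which fit because i + j \<le> n.\<close>
      define I where "I = (\<lambda>k. 2 * k) ` {..<i} \<union> {2 * i..<i + j}"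
      have I: "I \<subseteq> {0..<?n}" using ij assms(1) by (auto simp: I_def)
      have "card I = j" unfolding I_def using ij
        by (subst card_Un_disjoint) (auto simp: card_image inj_on_def)
      moreover have "inj_on e I" using bij_betw_imp_inj_on[OF e] I by (rule inj_on_subset)
      ultimately have card: "card (e ` I) = j" by (simp add: card_image)
      have mem: "e k \<in> e ` I \<longleftrightarrow> k \<in> I" if "k < ?n" for k
        using that I e_eq by (auto simp: subset_iff)
      have "cube_point (e ` I) \<notin> pair k" if k: "k < i" for k
      proof -
        have "e (2 * k) \<in> e ` I" using k by (auto simp: I_def)
        moreover have "2 * k + 1 \<notin> I" using k by (auto simp: I_def) presburger
        then have "e (2 * k + 1) \<notin> e ` I" using mem[of "2 * k + 1"] k assms(1) by auto
        ultimately show ?thesis using pair by blast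
      qed
      moreover have "cube_point (e ` I) \<notin> level l" if "l \<in> F" for l
        using that j card level by auto
      ultimately have "cube_point (e ` I) \<notin> \<Union>\<H>" by (auto simp: \<H>_def)
      moreover have "cube_point (e ` I) \<in> layers {j}" using card by simp
      ultimately show "\<not> layers {j} \<subseteq> \<Union>\<H>" by blast
    qed
  qed
qed

lemma admitting_imp_nontrivial_hyperplane_cover:
  assumes "admitting CARD('n) d E" "d \<le> CARD('n)" "E \<subseteq> {0..CARD('n)}"
  obtains \<H> :: "(real ^ 'n::finite) set set" where "finite \<H>" "card \<H> \<le> d" "nontrivial_hyperplane_cover E \<H>"
proof -
  let ?n = "CARD('n)"
  obtain i where i: "i \<le> d" "E \<union> T ?n i \<noteq> {0..?n}" "card (E - T ?n i) \<le> d - i"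
    using assms(1) unfolding admitting_def admitting_at_def by fastforce
  have sub: "E \<union> T ?n i \<subseteq> {0..?n}" using assms i T_subset by (metis le_trans sup.boundedI)
  then have "E \<union> T ?n i \<subset> {0..?n}" using i(2) by blast
  then obtain j where j: "j \<le> ?n" "j \<notin> E \<union> T ?n i" by (metis atLeastAtMost_iff psubset_imp_ex_mem Diff_iff)
  \<comment> \<open>The missed weight j satisfies i \<le> j \<le> n - i. It also yields
    nontriviality below, since its layer stays uncovered.\<close>
  have "2 * i \<le> ?n" using j by (auto simp: T_def)
  moreover have "finite (E - T ?n i)" using assms(3) finite_subset by blast
  ultimately obtain \<H> :: "(real ^ 'n) set set" where H: "finite \<H>" "card \<H> \<le> i + card (E - T ?n i)"
    "\<forall>H\<in>\<H>. hyperplane H" "layers (E - T ?n i \<union> T ?n i) \<subseteq> \<Union>\<H>"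
    "\<forall>j\<in>{0..?n} - (E - T ?n i \<union> T ?n i). \<not> layers {j} \<subseteq> \<Union>\<H>"
    by (rule balanced_hyperplane_family)
  have "layers E \<subseteq> cube \<inter> \<Union>\<H>" using H(4) by (auto simp: layers_def)
  moreover have "cube \<inter> \<Union>\<H> \<noteq> cube" using bspec[OF H(5), of j] j by (auto simp: layers_def)
  ultimately have "nontrivial_hyperplane_cover E \<H>" using H(3) by (simp add: nontrivial_hyperplane_cover_def)
  moreover have "card \<H> \<le> d" using H(2) i by linarith
  ultimately show ?thesis using that H(1) by blast
qed

text \<open>The 2k layers of \<open>T CARD('n) k\<close> cost k hyperplanes and the other |E| - 2k
  layers one each, |E| - k in total.\<close>

lemma exists_proper_hyperplane_cover:
  assumes "T CARD('n) k \<subseteq> E" "2 * k \<le> CARD('n)" "E \<subseteq> {0..CARD('n)}"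
  obtains \<H> :: "(real ^ 'n::finite) set set" where "finite \<H>" "card \<H> + k \<le> card E" "proper_hyperplane_cover E \<H>"
proof -
  let ?n = "CARD('n)"
  have fin: "finite E" using assms(3) finite_subset by blast
  have E: "E - T ?n k \<union> T ?n k = E" using assms(1) by blast
  obtain \<H> :: "(real ^ 'n) set set" where H: "finite \<H>" "card \<H> \<le> k + card (E - T ?n k)"
    "\<forall>H\<in>\<H>. hyperplane H" "layers (E - T ?n k \<union> T ?n k) \<subseteq> \<Union>\<H>"
    "\<forall>j\<in>{0..?n} - (E - T ?n k \<union> T ?n k). \<not> layers {j} \<subseteq> \<Union>\<H>"
    by (rule balanced_hyperplane_family[OF assms(2) finite_Diff[OF fin, of "T ?n k"]])
  have "card (E - T ?n k) + 2 * k = card E"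
    using card_T[OF assms(2)] card_mono[OF fin assms(1)] finite_subset[OF assms(1) fin] assms(1)
    by (simp add: card_Diff_subset)
  then have "card \<H> + k \<le> card E" using H(2) by linarith
  moreover have "proper_hyperplane_cover E \<H>" using H(3-5) unfolding E proper_hyperplane_cover_def by auto
  ultimately show ?thesis using that H(1) by blast
qed

section \<open>The two cycles of inequalities\<close>

theorem theorem1p5:
  fixes n :: nat and E :: "nat set"
  assumes "n = CARD('n::finite)" and "E \<subset> {0..n}"
  shows "HC TYPE('n) E = PC TYPE('n) E
       \<and> PC TYPE('n) E = Min {d \<in> {0..n}. admitting n d E}
       \<and> PHC TYPE('n) E = PPC TYPE('n) E
       \<and> int (PPC TYPE('n) E) = int (card E) - int (Max {i \<in> {0..n div 2}. T n i \<subseteq> E})"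
proof -
  have E: "E \<subseteq> {0..CARD('n)}" "E \<subset> {0..CARD('n)}" using assms by auto
  have cardE: "card E \<le> n" using psubset_card_mono[OF _ assms(2)] by simp

  \<comment> \<open>Part (a) follows from Min D \<le> PC \<le> HC \<le> Min D. As
    \<open>T n 0\<close> is empty, i = 0 shows that n belongs to \<open>D\<close>, so the minimum is
    attained.\<close>
  define D where "D = {d \<in> {0..n}. admitting n d E}"
  have "admitting_at n n 0 E" using assms(2) cardE by (auto simp: admitting_at_def T_def)
  then have "n \<in> D" by (auto simp: D_def admitting_def)
  moreover have finD: "finite D" by (simp add: D_def)
  ultimately have MinD: "Min D \<in> D" by (intro Min_in) auto
  then obtain \<H> :: "(real ^ 'n) set set" where H: "finite \<H>" "card \<H> \<le> Min D" "nontrivial_hyperplane_cover E \<H>"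
    using admitting_imp_nontrivial_hyperplane_cover[of "Min D" E] E assms(1) unfolding D_def by auto
  have "\<exists>\<H> :: (real ^ 'n) set set. finite \<H> \<and> card \<H> = HC TYPE('n) E \<and> nontrivial_hyperplane_cover E \<H>"
    unfolding HC_def by (rule LeastI[of _ "card \<H>"]) (use H in blast)
  then obtain \<G> :: "(real ^ 'n) set set" where G: "finite \<G>" "card \<G> = HC TYPE('n) E" "nontrivial_hyperplane_cover E \<G>"
    by blast
  have "HC TYPE('n) E \<le> card \<H>" unfolding HC_def by (rule Least_le) (use H in blast)
  then have HC_le: "HC TYPE('n) E \<le> Min D" using H(2) by linarith
  obtain P :: "'n real_mpoly" where P: "mpoly_degree P \<le> HC TYPE('n) E" "\<And>x. mpoly_eval P x = 0 \<longleftrightarrow> x \<in> \<Union>\<G>"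
    using hyperplane_union_as_mpoly_zeros[OF G(1)] G(2,3) unfolding nontrivial_hyperplane_cover_def by metis
  have "cube_zeros P = cube \<inter> \<Union>\<G>" using P(2) by (auto simp: cube_zeros_def)
  then have Pc: "nontrivial_polynomial_cover E P"
    using G(3) by (simp add: nontrivial_hyperplane_cover_def nontrivial_polynomial_cover_def)
  have "PC TYPE('n) E \<le> mpoly_degree P" unfolding PC_def by (rule Least_le) (use Pc in blast)
  then have PC_le: "PC TYPE('n) E \<le> HC TYPE('n) E" using P(1) by linarith
  have "\<exists>P :: 'n real_mpoly. mpoly_degree P = PC TYPE('n) E \<and> nontrivial_polynomial_cover E P"
    unfolding PC_def by (rule LeastI[of _ "mpoly_degree P"]) (use Pc in blast)
  then have "admitting n (PC TYPE('n) E) E"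
    using nontrivial_cover_imp_admitting E(1) assms(1) by metis
  \<comment> \<open>\<open>D\<close> only contains degrees up to n, so the upper bounds are used
    here before minimality can be applied.\<close>
  moreover have "PC TYPE('n) E \<le> n" using PC_le HC_le MinD by (auto simp: D_def)
  ultimately have "Min D \<le> PC TYPE('n) E" using finD by (intro Min_le) (auto simp: D_def)
  then have a: "HC TYPE('n) E = PC TYPE('n) E" "PC TYPE('n) E = Min D" using PC_le HC_le by auto

  \<comment> \<open>Part (b) follows from |E| \<le> PPC + k \<le> PHC + k \<le> |E|, where k is the
    maximum of \<open>K\<close>.\<close>
  define K where "K = {i \<in> {0..n div 2}. T n i \<subseteq> E}"
  define k where "k = Max K"
  have finK: "finite K" by (simp add: K_def)
  have "0 \<in> K" by (auto simp: K_def T_def)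
  then have "k \<in> K" unfolding k_def using finK by (intro Max_in) auto
  then have k: "T CARD('n) k \<subseteq> E" "2 * k \<le> CARD('n)" using assms(1) by (auto simp: K_def)
  have max: "i \<le> k" if "2 * i \<le> CARD('n)" "T CARD('n) i \<subseteq> E" for i
    unfolding k_def using finK that assms(1) by (intro Max_ge) (auto simp: K_def)
  obtain \<H>' :: "(real ^ 'n) set set" where H': "finite \<H>'" "card \<H>' + k \<le> card E" "proper_hyperplane_cover E \<H>'"
    using exists_proper_hyperplane_cover[OF k E(1)] by blast
  have "\<exists>\<H> :: (real ^ 'n) set set. finite \<H> \<and> card \<H> = PHC TYPE('n) E \<and> proper_hyperplane_cover E \<H>"
    unfolding PHC_def by (rule LeastI[of _ "card \<H>'"]) (use H' in blast)
  then obtain \<G>' :: "(real ^ 'n) set set" where G': "finite \<G>'" "card \<G>' = PHC TYPE('n) E" "proper_hyperplane_cover E \<G>'"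
    by blast
  have "PHC TYPE('n) E \<le> card \<H>'" unfolding PHC_def by (rule Least_le) (use H' in blast)
  then have PHC_le: "PHC TYPE('n) E + k \<le> card E" using H'(2) by linarith
  obtain Q :: "'n real_mpoly" where Q: "mpoly_degree Q \<le> PHC TYPE('n) E" "\<And>x. mpoly_eval Q x = 0 \<longleftrightarrow> x \<in> \<Union>\<G>'"
    using hyperplane_union_as_mpoly_zeros[OF G'(1)] G'(2,3) unfolding proper_hyperplane_cover_def by metis
  have "cube_zeros Q = cube \<inter> \<Union>\<G>'" using Q(2) by (auto simp: cube_zeros_def)
  \<comment> \<open>Proper hyperplane covers are stated with the whole union, whereas
    \<open>cube_zeros\<close> lives in the cube; for layers the two containments agree.\<close>
  moreover have "layers F \<subseteq> (cube :: (real ^ 'n) set)" for F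
    by (auto simp: layers_def)
  ultimately have Qc: "proper_polynomial_cover E Q"
    using G'(3) by (simp add: proper_hyperplane_cover_def proper_polynomial_cover_def)
  have "PPC TYPE('n) E \<le> mpoly_degree Q" unfolding PPC_def by (rule Least_le) (use Qc in blast)
  then have PPC_le: "PPC TYPE('n) E \<le> PHC TYPE('n) E" using Q(1) by linarith
  have "\<exists>P :: 'n real_mpoly. mpoly_degree P = PPC TYPE('n) E \<and> proper_polynomial_cover E P"
    unfolding PPC_def by (rule LeastI[of _ "mpoly_degree Q"]) (use Qc in blast)
  then have "card E \<le> PPC TYPE('n) E + k"
    using proper_cover_degree_ge[OF _ E(2) k max] by metis
  then have "PHC TYPE('n) E = PPC TYPE('n) E" "int (PPC TYPE('n) E) = int (card E) - int k"
    using PPC_le PHC_le by auto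
  then show ?thesis using a unfolding D_def k_def K_def by blast
qed

end
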